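(* Let $S(z,t)=z+\frac{zt}{1-t-T(z)^2}$ be the bivariate generating function of all Catalan--Stanley trees, with $T(z)=\frac{1-\sqrt{1-4z}}{2}$. Then \[ \frac{1}{1-t}\, S\Big(z,\frac{t}{1-t}T(z)^2\Big) = S(z,t). \]
   Context: A Catalan--Stanley tree is a rooted plane tree in which, for every child $c$ of the root, the leaf reached from $c$ by repeatedly moving to the rightmost child (the rightmost leaf of that branch) has odd distance to the root; the one-node tree is included. In $S(z,t)$, $t$ marks these rightmost leaves of the branches attached to the root and $z$ marks all other nodes. $T(z)$ is the generating function of rooted plane trees by number of nodes. *)

theory Defs
  imports Complex_Main "HOL-Computational_Algebra.Formal_Power_Series"
begin

datatype plane_tree = Node (branches: "plane_tree list")

primrec num_nodes :: "plane_tree \<Rightarrow> nat" where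
  "num_nodes (Node ts) = Suc (sum_list (map num_nodes ts))"

text \<open>
  A node is addressed by the list of child indices (from 0, left to right) on the path
  leading to it from the root, so that the length of the address is the distance to the root.
\<close>

function rightmost_leaf :: "plane_tree \<Rightarrow> nat list" where
  "rightmost_leaf (Node ts) =
     (if ts = [] then [] else (length ts - 1) # rightmost_leaf (last ts))"
  by pat_completeness auto
termination
proof (relation "measure size", simp)
  fix ts :: "plane_tree list"
  assume "ts \<noteq> []"
  then have "last ts \<in> set ts" by simp
  then have "size (last ts) \<le> size_list size ts" by (rule size_list_estimation') simp
  then show "(last ts, Node ts) \<in> measure size" by simp
qed

definition branch_leaves :: "plane_tree \<Rightarrow> nat list set" where
  "branch_leaves \<tau> =
     {i # rightmost_leaf (branches \<tau> ! i) | i. i < length (branches \<tau>)}"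

definition catalan_stanley :: "plane_tree \<Rightarrow> bool" where
  "catalan_stanley \<tau> \<longleftrightarrow> (\<forall>v \<in> branch_leaves \<tau>. odd (length v))"

definition plane_tree_gf :: "real fps" where
  "plane_tree_gf = Abs_fps (\<lambda>n. real (card {\<tau>. num_nodes \<tau> = n}))"

text \<open>
  A bivariate power series in \<open>z\<close> and \<open>t\<close> is a power series in \<open>t\<close> whose coefficients are
  power series in \<open>z\<close>. Hence \<^const>\<open>fps_X\<close> is \<open>t\<close>, a series \<open>F(z)\<close> is \<open>fps_const F\<close>, and
  substituting for \<open>t\<close> is \<^const>\<open>fps_compose\<close>. Division is meaningful whenever the divisor has
  nonzero constant term in both variables, even though the coefficients form no field.
\<close>

abbreviation z_var :: "real fps fps" where "z_var \<equiv> fps_const fps_X"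
abbreviation t_var :: "real fps fps" where "t_var \<equiv> fps_X"

text \<open>
  The coefficient of \<open>z^n t^k\<close> counts the trees with \<open>k\<close> marked leaves and \<open>n\<close> other nodes.
\<close>

definition catalan_stanley_gf :: "real fps fps" where
  "catalan_stanley_gf = Abs_fps (\<lambda>k. Abs_fps (\<lambda>n. real (card
     {\<tau>. catalan_stanley \<tau> \<and> card (branch_leaves \<tau>) = k \<and> num_nodes \<tau> = n + k})))"

end

theory Submission
  imports Defs
begin

text \<open>
  Splitting off the root gives \<open>T = z + T\<^sup>2\<close>. In a branch whose rightmost leaf has even depth \<open>2m\<close>,
  every inner node of the rightmost path carries a sequence of further trees to its left and so
  contributes \<open>z / (1 - T) = T\<close>; hence such branches, not counting the leaf, have
  generating function \<open>B = 1 / (1 - T\<^sup>2)\<close>. A Catalan--Stanley tree is a root with a sequence of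
  such branches, so \<open>S = z / (1 - t B)\<close>, that is \<open>S (1 - t - T\<^sup>2) = z (1 - T\<^sup>2)\<close>. Substituting
  \<open>u = t T\<^sup>2 / (1 - t)\<close> and using \<open>(1 - t) (1 - u - T\<^sup>2) = 1 - t - T\<^sup>2\<close> gives the identity.
\<close>

unbundle fps_syntax

subsection \<open>Counting series of weighted classes\<close>

text \<open>Guards the sum and product rules below: \<open>card\<close> of an infinite set is 0, so
  coefficients of \<open>class_gf\<close> add and multiply properly only over finite fibers.\<close>

definition finite_fibers :: "'a set \<Rightarrow> ('a \<Rightarrow> nat) \<Rightarrow> bool" where
  "finite_fibers A w \<longleftrightarrow> (\<forall>n. finite {a \<in> A. w a = n})"

definition class_gf :: "'a set \<Rightarrow> ('a \<Rightarrow> nat) \<Rightarrow> real fps" where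
  "class_gf A w = Abs_fps (\<lambda>n. real (card {a \<in> A. w a = n}))"

lemma class_gf_nth: "class_gf A w $ n = real (card {a \<in> A. w a = n})"
  by (simp add: class_gf_def)

lemma finite_fibers_subset: "finite_fibers B w \<Longrightarrow> A \<subseteq> B \<Longrightarrow> finite_fibers A w"
  unfolding finite_fibers_def by (blast intro: finite_subset[rotated])

lemma finite_fibers_image_iff:
  assumes "inj_on f A"
  shows "finite_fibers (f ` A) w \<longleftrightarrow> finite_fibers A (\<lambda>a. w (f a))"
proof -
  have "{b \<in> f ` A. w b = n} = f ` {a \<in> A. w (f a) = n}" for n by auto
  moreover have "inj_on f {a \<in> A. w (f a) = n}" for n
    using assms by (rule inj_on_subset) auto
  ultimately show ?thesis by (simp add: finite_fibers_def finite_image_iff)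
qed

lemma class_gf_image:
  assumes "inj_on f A"
  shows "class_gf (f ` A) w = class_gf A (\<lambda>a. w (f a))"
proof (rule fps_ext)
  fix n
  have "{b \<in> f ` A. w b = n} = f ` {a \<in> A. w (f a) = n}" by auto
  moreover have "inj_on f {a \<in> A. w (f a) = n}"
    using assms by (rule inj_on_subset) auto
  ultimately show "class_gf (f ` A) w $ n = class_gf A (\<lambda>a. w (f a)) $ n"
    by (simp add: class_gf_nth card_image)
qed

lemma class_gf_Un_disjoint:
  assumes "finite_fibers A w" "finite_fibers B w" "A \<inter> B = {}"
  shows "class_gf (A \<union> B) w = class_gf A w + class_gf B w"
proof (rule fps_ext)
  fix n
  have "{a \<in> A \<union> B. w a = n} = {a \<in> A. w a = n} \<union> {a \<in> B. w a = n}" by auto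
  then show "class_gf (A \<union> B) w $ n = (class_gf A w + class_gf B w) $ n"
    using assms by (simp add: class_gf_nth finite_fibers_def card_Un_disjoint disjoint_iff)
qed

lemma class_gf_singleton: "class_gf {a} w = fps_X ^ w a"
proof (rule fps_ext)
  fix n
  have "{x \<in> {a}. w x = n} = (if n = w a then {a} else {})" by auto
  then show "class_gf {a} w $ n = fps_X ^ w a $ n"
    by (simp add: class_gf_nth)
qed

lemma finite_fibers_singleton: "finite_fibers {a} w"
  by (simp add: finite_fibers_def)

lemma class_gf_Suc: "class_gf A (\<lambda>a. Suc (w a)) = fps_X * class_gf A w"
proof (rule fps_ext)
  fix n show "class_gf A (\<lambda>a. Suc (w a)) $ n = (fps_X * class_gf A w) $ n"
    by (cases n) (simp_all add: class_gf_nth)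
qed

text \<open>A pair of total weight \<open>n\<close> lies in exactly one rectangle
  \<open>?F n i\<close>, with \<open>i\<close> the weight of its first component; summing over
  \<open>i\<close> is the Cauchy product.\<close>

lemma class_gf_Times:
  assumes "finite_fibers A w" "finite_fibers B v"
  shows finite_fibers_Times: "finite_fibers (A \<times> B) (\<lambda>(a, b). w a + v b)"
    and "class_gf (A \<times> B) (\<lambda>(a, b). w a + v b) = class_gf A w * class_gf B v"
proof -
  let ?F = "\<lambda>n i. {a \<in> A. w a = i} \<times> {b \<in> B. v b = n - i}"
  have fin: "finite {a \<in> A. w a = n}" "finite {b \<in> B. v b = n}" for n
    using assms by (simp_all add: finite_fibers_def)
  have fiber: "{p \<in> A \<times> B. (\<lambda>(a, b). w a + v b) p = n} = (\<Union>i\<in>{0..n}. ?F n i)" for n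
    by auto
  have finF: "finite (?F n i)" for n i using fin by blast
  show "finite_fibers (A \<times> B) (\<lambda>(a, b). w a + v b)"
    unfolding finite_fibers_def fiber using finF by blast
  show "class_gf (A \<times> B) (\<lambda>(a, b). w a + v b) = class_gf A w * class_gf B v"
  proof (rule fps_ext)
    fix n
    have "card (\<Union>i\<in>{0..n}. ?F n i) = (\<Sum>i\<in>{0..n}. card (?F n i))"
      by (rule card_UN_disjoint) (use finF in auto)
    then show "class_gf (A \<times> B) (\<lambda>(a, b). w a + v b) $ n = (class_gf A w * class_gf B v) $ n"
      unfolding class_gf_nth fiber fps_mult_nth by (simp add: card_cartesian_product)
  qed
qed

lemma lists_length_Suc:
  "{xs \<in> lists A. length xs = Suc k} = (\<lambda>(x, xs). x # xs) ` (A \<times> {xs \<in> lists A. length xs = k})"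
  by (auto simp: length_Suc_conv image_iff)

text \<open>The length stays fixed because the class may contain objects of weight 0, which would
  give infinitely many lists of one weight. Finiteness is proved in the same induction since the
  product rule needs it.\<close>

lemma class_gf_lists_length:
  assumes "finite_fibers A w"
  shows finite_fibers_lists_length:
      "finite_fibers {xs \<in> lists A. length xs = k} (\<lambda>xs. sum_list (map w xs))"
    and "class_gf {xs \<in> lists A. length xs = k} (\<lambda>xs. sum_list (map w xs)) = class_gf A w ^ k"
proof (induction k)
  case 0
  have "{xs \<in> lists A. length xs = 0} = {[]}" by auto
  then show
    "finite_fibers {xs \<in> lists A. length xs = 0} (\<lambda>xs. sum_list (map w xs))"
    "class_gf {xs \<in> lists A. length xs = 0} (\<lambda>xs. sum_list (map w xs)) = class_gf A w ^ 0"
    by (simp_all only: finite_fibers_singleton class_gf_singleton) simp_all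
next
  case (Suc k)
  have inj: "inj_on (\<lambda>(x, xs). x # xs) (A \<times> {xs \<in> lists A. length xs = k})"
    by (auto simp: inj_on_def)
  have wt: "(\<lambda>p. sum_list (map w (case p of (x, xs) \<Rightarrow> x # xs)))
      = (\<lambda>(x, xs). w x + sum_list (map w xs))" by auto
  show "finite_fibers {xs \<in> lists A. length xs = Suc k} (\<lambda>xs. sum_list (map w xs))"
    unfolding lists_length_Suc finite_fibers_image_iff[OF inj] wt
    by (rule finite_fibers_Times[OF assms Suc(1)])
  show "class_gf {xs \<in> lists A. length xs = Suc k} (\<lambda>xs. sum_list (map w xs)) = class_gf A w ^ Suc k"
    unfolding lists_length_Suc class_gf_image[OF inj] wt class_gf_Times(2)[OF assms Suc(1)] Suc(2)
    by simp
qed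

subsection \<open>Plane trees\<close>

lemma num_nodes_pos: "num_nodes \<tau> > 0"
  by (cases \<tau>) simp

lemma length_le_sum_num_nodes: "length ts \<le> sum_list (map num_nodes ts)"
proof (induction ts)
  case (Cons \<tau> ts)
  then show ?case by (cases \<tau>) simp
qed simp

text \<open>Below a root with at most \<open>Suc n\<close> nodes in total hang at most
  \<open>n\<close> branches of at most \<open>n\<close> nodes each, which leaves finitely many
  choices by induction.\<close>

lemma finite_num_nodes_le: "finite {\<tau>. num_nodes \<tau> \<le> n}"
proof (induction n)
  case 0
  have "{\<tau>. num_nodes \<tau> \<le> 0} = {}" using num_nodes_pos by (simp add: not_le)
  then show ?case by (simp only: finite.emptyI)
next
  case (Suc n)
  let ?L = "{ts. set ts \<subseteq> {\<tau>. num_nodes \<tau> \<le> n} \<and> length ts \<le> n}"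
  have "{\<tau>. num_nodes \<tau> \<le> Suc n} \<subseteq> Node ` ?L"
  proof
    fix \<tau> assume "\<tau> \<in> {\<tau>. num_nodes \<tau> \<le> Suc n}"
    then obtain ts where ts: "\<tau> = Node ts" "sum_list (map num_nodes ts) \<le> n"
      by (cases \<tau>) auto
    have "num_nodes \<sigma> \<le> n" if "\<sigma> \<in> set ts" for \<sigma>
      using member_le_sum_list[of "num_nodes \<sigma>" "map num_nodes ts"] that ts(2) by simp
    moreover have "length ts \<le> n" using length_le_sum_num_nodes ts(2) by (rule order_trans)
    ultimately show "\<tau> \<in> Node ` ?L" using ts(1) by auto
  qed
  then show ?case using finite_lists_length_le[OF Suc] finite_surj by blast
qed

lemma finite_fibers_num_nodes: "finite_fibers A num_nodes"
  unfolding finite_fibers_def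
  by (intro allI finite_subset[OF _ finite_num_nodes_le]) auto

section \<open>Forests and the quadratic equation for T\<close>

abbreviation forest_nodes :: "plane_tree list \<Rightarrow> nat" where
  "forest_nodes ts \<equiv> sum_list (map num_nodes ts)"

text \<open>This is the series \<open>1 / (1 - T)\<close> of sequences of plane trees.\<close>

definition forest_gf :: "real fps" where
  "forest_gf = class_gf UNIV forest_nodes"

lemma inj_Node: "inj_on Node A"
  by (simp add: inj_on_def)

lemma range_Node: "range Node = UNIV"
  using plane_tree.exhaust by (auto simp: image_iff) metis

lemma finite_fibers_forest_nodes: "finite_fibers A forest_nodes"
proof -
  have "finite_fibers UNIV (\<lambda>ts. num_nodes (Node ts))"
    unfolding finite_fibers_image_iff[OF inj_Node, symmetric] by (rule finite_fibers_num_nodes)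
  then have "finite {ts. Suc (forest_nodes ts) = Suc n}" for n
    unfolding finite_fibers_def num_nodes.simps by (simp only: UNIV_I simp_thms)
  then have "finite_fibers UNIV forest_nodes" by (simp add: finite_fibers_def)
  then show ?thesis by (rule finite_fibers_subset) simp
qed

lemma plane_tree_gf_eq_class_gf: "plane_tree_gf = class_gf UNIV num_nodes"
  by (simp add: plane_tree_gf_def class_gf_def)

lemma plane_tree_gf_forest: "plane_tree_gf = fps_X * forest_gf"
proof -
  have "plane_tree_gf = class_gf (range Node) num_nodes"
    by (simp add: plane_tree_gf_eq_class_gf range_Node)
  also have "\<dots> = fps_X * forest_gf"
    by (simp add: class_gf_image[OF inj_Node] class_gf_Suc forest_gf_def)
  finally show ?thesis .
qed

text \<open>A forest is empty or splits uniquely into its first tree and the remaining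
  forest.\<close>

lemma forest_gf_rec: "forest_gf = 1 + plane_tree_gf * forest_gf"
proof -
  let ?C = "\<lambda>(\<tau>, ts). \<tau> # ts"
  have inj: "inj_on ?C (UNIV \<times> UNIV)" by (auto simp: inj_on_def)
  have "(UNIV :: plane_tree list set) = {[]} \<union> ?C ` (UNIV \<times> UNIV)"
    by (auto simp: image_iff) (metis list.exhaust)
  then have "forest_gf = class_gf ({[]} \<union> ?C ` (UNIV \<times> UNIV)) forest_nodes"
    by (simp add: forest_gf_def)
  also have "\<dots> = class_gf {[]} forest_nodes + class_gf (?C ` (UNIV \<times> UNIV)) forest_nodes"
    by (intro class_gf_Un_disjoint finite_fibers_forest_nodes) auto
  also have "class_gf (?C ` (UNIV \<times> UNIV)) forest_nodes
      = class_gf (UNIV \<times> UNIV) (\<lambda>(\<tau>, ts). num_nodes \<tau> + forest_nodes ts)"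
    unfolding class_gf_image[OF inj] by (rule arg_cong2[where f = class_gf]) auto
  also have "\<dots> = plane_tree_gf * forest_gf"
    unfolding plane_tree_gf_eq_class_gf forest_gf_def
    by (rule class_gf_Times(2)[OF finite_fibers_num_nodes finite_fibers_forest_nodes])
  finally show ?thesis by (simp add: class_gf_singleton)
qed

lemma plane_tree_gf_rec: "plane_tree_gf = fps_X + plane_tree_gf ^ 2"
  by (subst plane_tree_gf_forest, subst forest_gf_rec)
    (simp add: plane_tree_gf_forest algebra_simps power2_eq_square)

lemma plane_tree_gf_nth_0: "plane_tree_gf $ 0 = 0"
  by (simp add: plane_tree_gf_forest)

text \<open>Completing the square in T = z + T^2 shows that 1 - 2T squares to 1 - 4z; its constant
  term 1 singles out this square root.\<close>

lemma plane_tree_gf_closed_form: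
  "plane_tree_gf = (1 - fps_radical root 2 (1 - 4 * fps_X)) / 2"
proof -
  let ?T = plane_tree_gf
  have sq: "(1 - 2 * ?T) ^ Suc 1 = 1 - 4 * fps_X"
  proof -
    have X: "fps_X = ?T - ?T ^ 2" using plane_tree_gf_rec by (simp add: algebra_simps)
    show ?thesis unfolding X by (simp add: algebra_simps power2_eq_square)
  qed
  have "1 - 2 * ?T = fps_radical root (Suc 1) (1 - 4 * fps_X)"
    by (rule iffD1[OF radical_unique sq])
      (simp_all add: fps_numeral_nth plane_tree_gf_nth_0 fps_mult_nth_0)
  then have "2 * ?T = 1 - fps_radical root 2 (1 - 4 * fps_X)"
    by (simp add: numeral_2_eq_2 algebra_simps)
  then show ?thesis
    by (metis nonzero_mult_div_cancel_left zero_neq_numeral)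
qed

subsection \<open>Branches and Catalan--Stanley trees\<close>

lemma finite_fibers_num_nodes_minus_1: "finite_fibers A (\<lambda>\<tau>. num_nodes \<tau> - 1)"
  unfolding finite_fibers_def
proof
  fix n
  show "finite {\<tau> \<in> A. num_nodes \<tau> - 1 = n}"
    by (rule finite_subset[OF _ finite_num_nodes_le[of "Suc n"]]) auto
qed

abbreviation (input) rightmost_depth :: "plane_tree \<Rightarrow> nat" where
  "rightmost_depth \<tau> \<equiv> length (rightmost_leaf \<tau>)"

text \<open>The rightmost leaf is left out of the weight, as it is marked by \<open>t\<close> and not by \<open>z\<close>.\<close>

definition depth_gf :: "(nat \<Rightarrow> bool) \<Rightarrow> real fps" where
  "depth_gf P = class_gf {\<tau>. P (rightmost_depth \<tau>)} (\<lambda>\<tau>. num_nodes \<tau> - 1)"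

text \<open>The root and the forest to the left of the last branch contribute z / (1 - T) = T. The
  omitted rightmost leaf is shared by the tree and its last branch.\<close>

lemma class_gf_Node_snoc:
  "class_gf ((\<lambda>(ts, \<tau>). Node (ts @ [\<tau>])) ` (UNIV \<times> {\<tau>. P (rightmost_depth \<tau>)}))
     (\<lambda>\<tau>. num_nodes \<tau> - 1) = plane_tree_gf * depth_gf P"
proof -
  let ?A = "{\<tau>. P (rightmost_depth \<tau>)}" and ?f = "\<lambda>(ts, \<tau>). Node (ts @ [\<tau>])"
  have inj: "inj_on ?f (UNIV \<times> ?A)" by (auto simp: inj_on_def)
  \<comment> \<open>Since the last branch has a node, the subtracted 1 can be charged to it without
    truncation.\<close>
  have wt: "(\<lambda>p. num_nodes (?f p) - 1)
      = (\<lambda>p. Suc (case p of (ts, \<tau>) \<Rightarrow> forest_nodes ts + (num_nodes \<tau> - 1)))"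
    by (auto simp: fun_eq_iff num_nodes_pos)
  have "class_gf (?f ` (UNIV \<times> ?A)) (\<lambda>\<tau>. num_nodes \<tau> - 1)
      = fps_X * class_gf (UNIV \<times> ?A) (\<lambda>(ts, \<tau>). forest_nodes ts + (num_nodes \<tau> - 1))"
    unfolding class_gf_image[OF inj] wt class_gf_Suc ..
  also have "\<dots> = fps_X * (forest_gf * depth_gf P)"
    unfolding forest_gf_def depth_gf_def
    by (subst class_gf_Times(2)[OF finite_fibers_forest_nodes finite_fibers_num_nodes_minus_1]) simp
  finally show ?thesis by (simp add: plane_tree_gf_forest mult.assoc)
qed

text \<open>The rightmost path either stops at the root or enters the last branch, one level
  deeper.\<close>

lemma Collect_rightmost_depth:
  "{\<tau>. P (rightmost_depth \<tau>)} = (if P 0 then {Node []} else {}) \<union>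
     (\<lambda>(ts, \<tau>). Node (ts @ [\<tau>])) ` (UNIV \<times> {\<tau>. P (Suc (rightmost_depth \<tau>))})" (is "?L = ?R")
proof (rule set_eqI)
  fix \<sigma>
  obtain us where us: "\<sigma> = Node us" by (cases \<sigma>)
  show "\<sigma> \<in> ?L \<longleftrightarrow> \<sigma> \<in> ?R"
    by (cases us rule: rev_cases) (auto simp: us image_iff)
qed

lemma depth_gf_odd: "depth_gf odd = plane_tree_gf * depth_gf even"
  using class_gf_Node_snoc[of even]
  by (subst depth_gf_def, subst Collect_rightmost_depth) simp

text \<open>Unless the tree is a single leaf, of weight 0, two levels can be peeled off its
  rightmost path, each worth a factor T.\<close>

lemma depth_gf_even_rec: "depth_gf even = 1 + plane_tree_gf ^ 2 * depth_gf even"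
proof -
  let ?N = "(\<lambda>(ts, \<tau>). Node (ts @ [\<tau>])) ` (UNIV \<times> {\<tau>. odd (rightmost_depth \<tau>)})"
  have "depth_gf even = class_gf ({Node []} \<union> ?N) (\<lambda>\<tau>. num_nodes \<tau> - 1)"
    by (subst depth_gf_def, subst Collect_rightmost_depth) simp
  also have "\<dots> = class_gf {Node []} (\<lambda>\<tau>. num_nodes \<tau> - 1) + class_gf ?N (\<lambda>\<tau>. num_nodes \<tau> - 1)"
    by (intro class_gf_Un_disjoint finite_fibers_num_nodes_minus_1) auto
  also have "\<dots> = 1 + plane_tree_gf * depth_gf odd"
    using class_gf_Node_snoc[of odd] by (simp add: class_gf_singleton)
  finally show ?thesis by (simp add: depth_gf_odd power2_eq_square mult.assoc)
qed

section \<open>Assembling Catalan--Stanley trees from their branches\<close>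

lemma card_branch_leaves: "card (branch_leaves (Node ts)) = length ts"
proof -
  have "branch_leaves (Node ts) = (\<lambda>i. i # rightmost_leaf (ts ! i)) ` {..<length ts}"
    by (auto simp: branch_leaves_def)
  \<comment> \<open>The leading child index separates the addresses even when their tails
    agree.\<close>
  moreover have "inj_on (\<lambda>i. i # rightmost_leaf (ts ! i)) {..<length ts}"
    by (auto simp: inj_on_def)
  ultimately show ?thesis by (simp add: card_image)
qed

text \<open>The edge from the root to the branch adds 1 to the distance, turning odd into
  even.\<close>

lemma catalan_stanley_Node:
  "catalan_stanley (Node ts) \<longleftrightarrow> ts \<in> lists {\<tau>. even (rightmost_depth \<tau>)}"
proof -
  have "catalan_stanley (Node ts) \<longleftrightarrow> (\<forall>i < length ts. even (rightmost_depth (ts ! i)))"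
    by (force simp: catalan_stanley_def branch_leaves_def)
  then show ?thesis by (simp add: in_lists_conv_set all_set_conv_all_nth)
qed

lemma forest_nodes_eq_length_plus:
  "forest_nodes ts = sum_list (map (\<lambda>\<tau>. num_nodes \<tau> - 1) ts) + length ts"
proof (induction ts)
  case (Cons \<tau> ts)
  then show ?case using num_nodes_pos[of \<tau>] by simp
qed simp

lemma catalan_stanley_gf_nth: "catalan_stanley_gf $ k = fps_X * depth_gf even ^ k"
proof -
  let ?E = "{\<tau>. even (rightmost_depth \<tau>)}" and ?w = "\<lambda>\<tau>. num_nodes \<tau> - 1"
  have "catalan_stanley_gf $ k
      = class_gf {ts \<in> lists ?E. length ts = k} (\<lambda>ts. Suc (sum_list (map ?w ts)))"
  proof (rule fps_ext)
    fix n
    let ?B = "{ts \<in> {ts \<in> lists ?E. length ts = k}. Suc (sum_list (map ?w ts)) = n}"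
    \<comment> \<open>The \<open>k\<close> marked leaves, one per branch, account for the summand
      \<open>k\<close>; the root is the \<open>Suc\<close> in the weight.\<close>
    have "{\<tau>. catalan_stanley \<tau> \<and> card (branch_leaves \<tau>) = k \<and> num_nodes \<tau> = n + k} = Node ` ?B"
      (is "?A = _")
    proof (rule set_eqI)
      fix \<tau>
      obtain ts where "\<tau> = Node ts" by (cases \<tau>)
      then show "\<tau> \<in> ?A \<longleftrightarrow> \<tau> \<in> Node ` ?B"
        by (auto simp: catalan_stanley_Node card_branch_leaves forest_nodes_eq_length_plus)
    qed
    then show "catalan_stanley_gf $ k $ n
        = class_gf {ts \<in> lists ?E. length ts = k} (\<lambda>ts. Suc (sum_list (map ?w ts))) $ n"
      by (simp add: catalan_stanley_gf_def class_gf_nth card_image[OF inj_Node])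
  qed
  then show ?thesis
    by (simp only: class_gf_Suc class_gf_lists_length(2)[OF finite_fibers_num_nodes_minus_1] depth_gf_def)
qed

section \<open>Clearing denominators and substituting for t\<close>

lemma catalan_stanley_gf_mult_denominator:
  "catalan_stanley_gf * (1 - t_var - fps_const plane_tree_gf ^ 2)
     = z_var * (1 - fps_const plane_tree_gf ^ 2)"
proof -
  let ?S = catalan_stanley_gf and ?B = "fps_const (depth_gf even)"
    and ?Q = "fps_const plane_tree_gf ^ 2 :: real fps fps"
  \<comment> \<open>Geometric series in t: passing from t^k to t^(k+1) multiplies the coefficient by
    \<open>depth_gf even\<close>.\<close>
  have rec: "?S = z_var + ?B * (t_var * ?S)"
  proof (rule fps_ext)
    fix k show "?S $ k = (z_var + ?B * (t_var * ?S)) $ k"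
      by (cases k) (simp_all add: catalan_stanley_gf_nth mult.left_commute)
  qed
  have "depth_gf even * (1 - plane_tree_gf ^ 2) = 1"
    using depth_gf_even_rec by (simp add: algebra_simps)
  then have "fps_const (depth_gf even * (1 - plane_tree_gf ^ 2)) = 1" by simp
  then have B: "?B * (1 - ?Q) = 1"
    by (simp add: fps_const_power fps_const_sub[symmetric] fps_const_mult[symmetric] del: fps_const_sub fps_const_mult)
  \<comment> \<open>Multiplying by the inverse \<open>1 - ?Q\<close> of \<open>?B\<close> eliminates
    \<open>?B\<close>.\<close>
  have "(1 - ?Q) * ?S = (1 - ?Q) * z_var + (?B * (1 - ?Q)) * (t_var * ?S)"
    by (subst rec) (simp add: algebra_simps)
  then show ?thesis unfolding B by (simp add: algebra_simps)
qed

text \<open>The nonzero real constant term makes \<open>d $ 0\<close> a unit among the series in z,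
  and hence \<open>d\<close> a unit among the series in t over them.\<close>

lemma fps_divide_mult_cancel:
  fixes f d :: "real fps fps"
  assumes "d $ 0 $ 0 \<noteq> 0"
  shows "f / d * d = f"
proof -
  have "d $ 0 \<noteq> 0" using assms by auto
  moreover have "d * inverse d = 1"
    unfolding fps_inverse_def
    by (rule fps_right_inverse) (rule inverse_mult_eq_1'[OF assms, unfolded fps_inverse_def])
  ultimately show ?thesis by (simp add: fps_divide_unit mult_ac)
qed

theorem mainTheorem3:
  fixes T :: "real fps" and S :: "real fps fps"
  defines "T \<equiv> plane_tree_gf" and "S \<equiv> catalan_stanley_gf"
  shows "T = (1 - fps_radical root 2 (1 - 4 * fps_X)) / 2 \<and>
         S = z_var + z_var * t_var / (1 - t_var - fps_const T ^ 2) \<and>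
         1 / (1 - t_var) * (S oo (t_var / (1 - t_var) * fps_const T ^ 2)) = S"
proof (intro conjI)
  let ?Q = "fps_const T ^ 2 :: real fps fps"
  let ?D = "1 - t_var - ?Q"
  have S: "S * ?D = z_var * (1 - ?Q)"
    unfolding S_def T_def by (rule catalan_stanley_gf_mult_denominator)
  have D0: "?D $ 0 $ 0 \<noteq> 0"
    by (simp add: T_def plane_tree_gf_nth_0 fps_const_power power2_eq_square)
  then have D: "?D \<noteq> 0" by (metis fps_zero_nth)
  show "T = (1 - fps_radical root 2 (1 - 4 * fps_X)) / 2"
    unfolding T_def by (rule plane_tree_gf_closed_form)
  \<comment> \<open>Both sides are compared after multiplication by \<open>?D\<close>, which can be
    cancelled because bivariate series form an integral domain.\<close>
  have "(z_var + z_var * t_var / ?D) * ?D = z_var * ?D + z_var * t_var"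
    using fps_divide_mult_cancel[OF D0] by (simp add: distrib_right)
  also have "\<dots> = S * ?D" unfolding S by (simp add: algebra_simps)
  finally show "S = z_var + z_var * t_var / ?D" using D by (metis mult_right_cancel)
  define u where "u = t_var / (1 - t_var) * ?Q"
  define r :: "real fps fps" where "r = 1 / (1 - t_var)"
  have t0: "(1 - t_var :: real fps fps) $ 0 $ 0 \<noteq> 0" by simp
  have r: "r * (1 - t_var) = 1"
    unfolding r_def by (rule fps_divide_mult_cancel[OF t0])
  have u: "u * (1 - t_var) = t_var * ?Q"
    using fps_divide_mult_cancel[OF t0, of t_var] by (simp add: u_def mult_ac)
  \<comment> \<open>A vanishing constant term in t makes substitution of \<open>u\<close> compatible
    with products.\<close>
  have "(u * (1 - t_var)) $ 0 = 0" unfolding u by simp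
  then have u0: "u $ 0 = 0" by simp
  \<comment> \<open>Substitution in the cleared equation fixes \<open>z_var\<close> and
    \<open>?Q\<close>, which are constant in t.\<close>
  have "(S oo u) * (1 - u - ?Q) = z_var * (1 - ?Q)"
    using arg_cong[OF S, of "\<lambda>f. f oo u"]
    by (simp add: fps_compose_mult_distrib[OF u0] fps_compose_sub_distrib fps_const_power u0)
  \<comment> \<open>On expanding, the cross term \<open>t_var * ?Q\<close> cancels against
    \<open>u * (1 - t_var)\<close>; this is what the choice of \<open>u\<close> achieves.\<close>
  moreover have "?D = (1 - t_var) * (1 - u - ?Q)"
    using u by (simp add: algebra_simps)
  ultimately have "r * (S oo u) * ?D = (r * (1 - t_var)) * (z_var * (1 - ?Q))"
    by (simp add: mult_ac)
  also have "\<dots> = S * ?D" unfolding r S by simp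
  finally show "1 / (1 - t_var) * (S oo (t_var / (1 - t_var) * ?Q)) = S"
    using D unfolding r_def u_def by (metis mult_right_cancel)
qed

end
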